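(* Let $N\ge 1$. For a given mass $m>0$ there exists a 3-node $\mathbf b^*\in\mathbb C^{2N+1}$ that is a minimizer of $H$ subject to $M(\mathbf b^* )=m$. It is the unique minimizer of $H$ (at mass $m$) up to translations and phase rotations. Namely, for each lattice site $k\in\{-N+1,\dots,N-1\}$ and phase $\theta\in[0,2\pi)$ there exists a minimizing $\mathbf b^*=\mathbf b^*(m,k,\theta)$ given by $$b^*_{k-1}=b^*_{k+1}=\sqrt{\tfrac{3m}{11}}\,e^{i\theta},\qquad b^*_k=\sqrt{\tfrac{5m}{11}}\,e^{i\theta},\qquad b^*_j=0\ \text{ for all } j \text{ with } |k-j|>1,$$ and this family represents all of the minimizers of the energy $H$ for fixed mass $m$.
   Context: Elements of $\mathbb C^{2N+1}$ are written $\mathbf b=(b_{-N},\dots,b_N)$, with the boundary convention $b_{-(N+1)}=b_{N+1}=0$. The energy and mass are $$H(\mathbf b)=\sum_{j=-N}^N\Big(\tfrac12|b_j|^4-2\,\mathrm{Re}(\bar b_j^2b_{j-1}^2)\Big),\qquad M(\mathbf b)=\sum_{j=-N}^N|b_j|^2 .$$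
   Formalization: Since H depends only on the squares b_j^2, flipping the sign of any single entry preserves H and M; so uniqueness and "this family represents all of the minimizers" are stated up to translations, phase rotations and independent signs ±1 at each site. *)

theory Defs
  imports Complex_Main
begin

text \<open>
  A vector \<open>(b_{-N}, ..., b_N)\<close> is encoded as a function on all of \<open>\<int>\<close> that vanishes
  outside \<open>{-N..N}\<close>; this builds in the boundary convention \<open>b_{-(N+1)} = b_{N+1} = 0\<close>.
\<close>

definition states :: "nat \<Rightarrow> (int \<Rightarrow> complex) set" where
  "states N = {b. \<forall>j. j \<notin> {- int N..int N} \<longrightarrow> b j = 0}"

definition energy :: "nat \<Rightarrow> (int \<Rightarrow> complex) \<Rightarrow> real" where
  "energy N b =
     (\<Sum>j = - int N..int N. 1 / 2 * cmod (b j) ^ 4 - 2 * Re ((cnj (b j))\<^sup>2 * (b (j - 1))\<^sup>2))"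

definition mass :: "nat \<Rightarrow> (int \<Rightarrow> complex) \<Rightarrow> real" where
  "mass N b = (\<Sum>j = - int N..int N. (cmod (b j))\<^sup>2)"

definition is_minimizer :: "nat \<Rightarrow> real \<Rightarrow> (int \<Rightarrow> complex) \<Rightarrow> bool" where
  "is_minimizer N m b \<longleftrightarrow>
     b \<in> states N \<and> mass N b = m \<and>
     (\<forall>c \<in> states N. mass N c = m \<longrightarrow> energy N b \<le> energy N c)"

definition is_3node :: "(int \<Rightarrow> complex) \<Rightarrow> bool" where
  "is_3node b \<longleftrightarrow> (\<exists>k. {j. b j \<noteq> 0} = {k - 1, k, k + 1})"

definition three_node :: "real \<Rightarrow> int \<Rightarrow> real \<Rightarrow> int \<Rightarrow> complex" where
  "three_node m k \<theta> j =
     (if j = k then of_real (sqrt (5 * m / 11)) * cis \<theta>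
      else if j = k - 1 \<or> j = k + 1 then of_real (sqrt (3 * m / 11)) * cis \<theta>
      else 0)"

text \<open>
  The energy depends on each \<open>b_j\<close> only through \<open>b_j\<^sup>2\<close>, so besides the global phase
  rotation it admits the rotation by \<open>\<pi>\<close> of any single site. A choice of such
  rotations is a function with values in \<open>{1, -1}\<close>.
\<close>

definition site_signs :: "(int \<Rightarrow> complex) set" where
  "site_signs = {\<sigma>. \<forall>j. \<sigma> j = 1 \<or> \<sigma> j = -1}"

lemma site_signs_simps:
  assumes "\<sigma> \<in> site_signs"
  shows "(\<sigma> j)\<^sup>2 = 1" "cnj (\<sigma> j) = \<sigma> j" "cmod (\<sigma> j) = 1"
proof -
  have "\<sigma> j = 1 \<or> \<sigma> j = -1"
    using assms by (simp add: site_signs_def)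
  then show "(\<sigma> j)\<^sup>2 = 1" "cnj (\<sigma> j) = \<sigma> j" "cmod (\<sigma> j) = 1"
    by (elim disjE; simp)+
qed

lemma is_minimizer_site_signs:
  assumes "\<sigma> \<in> site_signs" "is_minimizer N m b"
  shows "is_minimizer N m (\<lambda>j. \<sigma> j * b j)"
proof -
  have "energy N (\<lambda>j. \<sigma> j * b j) = energy N b" "mass N (\<lambda>j. \<sigma> j * b j) = mass N b"
    using assms(1)
    unfolding energy_def mass_def
    by (simp_all add: norm_mult power_mult_distrib site_signs_simps)
  with assms(2) show ?thesis
    by (simp add: is_minimizer_def states_def)
qed

text \<open>
  Hence the vectors \<open>three_node m k \<theta>\<close> alone can never exhaust the minimizers: flipping the
  sign of the left neighbour of the central site leaves that family.
\<close>

lemma three_node_family_not_exhaustive: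
  assumes "m > 0" "is_minimizer N m (three_node m k \<theta>)"
  shows "\<exists>b. is_minimizer N m b \<and> (\<forall>k' \<theta>'. b \<noteq> three_node m k' \<theta>')"
proof -
  define \<sigma> :: "int \<Rightarrow> complex" where "\<sigma> j = (if j = k - 1 then -1 else 1)" for j
  define b where "b j = \<sigma> j * three_node m k \<theta> j" for j
  have "\<sigma> \<in> site_signs" by (auto simp: \<sigma>_def site_signs_def)
  then have min: "is_minimizer N m b"
    using is_minimizer_site_signs[OF _ assms(2)] by (simp add: b_def[abs_def])
  have supp: "{j. three_node m i t j \<noteq> 0} = {i - 1, i, i + 1}" for i t
    using assms(1) by (auto simp: three_node_def)
  have "b \<noteq> three_node m k' \<theta>'" for k' \<theta>'
  proof
    assume eq: "b = three_node m k' \<theta>'"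
    have "{j. b j \<noteq> 0} = {k - 1, k, k + 1}"
      using supp[of k \<theta>] by (auto simp: b_def \<sigma>_def)
    with eq supp[of k' \<theta>'] have s: "{k' - 1, k', k' + 1} = {k - 1, k, k + 1}" by simp
    have Min: "Min {i - 1, i, i + 1} = i - 1" for i :: int by simp
    have "k' - 1 = k - 1" using arg_cong[OF s, of Min] unfolding Min .
    then have "k' = k" by simp
    then have "three_node m k' \<theta>' (k - 1) = three_node m k' \<theta>' (k + 1)"
      by (simp add: three_node_def)
    with eq have "b (k - 1) = b (k + 1)" by simp
    moreover have "b (k - 1) = - b (k + 1)" "b (k + 1) \<noteq> 0"
      using assms(1) by (simp_all add: b_def \<sigma>_def three_node_def)
    ultimately show False by simp
  qed
  with min show ?thesis by blast
qed

end

theory Submission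
  imports Defs
begin

text \<open>
  Since \<open>Re z \<le> cmod z\<close>, \<open>Re ((cnj (b j))\<^sup>2 * (b (j - 1))\<^sup>2)\<close> is at most the product of the
  site masses \<open>x j = (cmod (b j))\<^sup>2\<close> and \<open>x (j - 1)\<close>. Hence the energy is bounded below by the
  quadratic form \<open>\<Sum>j. 1 / 2 * (x j)\<^sup>2 - 2 * x j * x (j - 1)\<close>, with equality iff neighbouring
  nonzero sites agree in phase up to sign. Everything thus reduces to minimizing this form over
  nonnegative \<open>x\<close> of total mass \<open>m\<close>. The minimum should be \<open>- 7 / 22 * m\<^sup>2\<close>, attained exactly at
  the multiples of \<open>(3, 5, 3)\<close> on three consecutive sites; homogenizing, the claim is that the
  form \<open>deficit\<close> is nonnegative on nonnegative vectors and vanishes only there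
  (\<open>deficit_nonneg\<close>).

  The deficit is not positive semidefinite on four or more sites, so this is a copositivity
  statement. It is proved by strong induction on the number of occupied sites, without any
  compactness argument. There are three cases.

  \<^item> The occupied sites fit into a window of three. There the deficit is an explicit sum of two
    squares, whose common zeros are the multiples of \<open>(3, 5, 3)\<close> (\<open>deficit_three_sites\<close>).

  \<^item> There is an empty site between occupied ones. The two parts do not interact in the energy,
    and the square of the total mass makes the deficit strictly superadditive
    (\<open>deficit_split\<close>).

  \<^item> Four consecutive sites are occupied. Moving mass in the direction \<open>(3, 2, -2, -3)\<close> preserves
    the total mass, and the energy is strictly concave along this line. Sliding downhill until
    a site becomes empty strictly decreases the deficit and shrinks the support
    (\<open>deficit_decreases\<close>).

  In the equality case the three amplitudes are known and only the two bonds next to the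
  centre remain; each fixes the phase of an outer site relative to the centre up to sign
  (\<open>square_overlap_maximal_imp_aligned\<close>), which gives the family of the theorem.
\<close>

section \<open>The quadratic form in the site masses\<close>

definition chain_energy :: "int set \<Rightarrow> (int \<Rightarrow> real) \<Rightarrow> real" where
  "chain_energy I x = (\<Sum>j\<in>I. 1 / 2 * (x j)\<^sup>2 - 2 * x j * x (j - 1))"

text \<open>
  The excess of the energy over the least value \<open>- 7 / 22 * (sum x I)\<^sup>2\<close>, cleared of
  denominators. Homogeneity in \<open>x\<close> lets the induction change the total mass freely.
\<close>

definition deficit :: "int set \<Rightarrow> (int \<Rightarrow> real) \<Rightarrow> real" where
  "deficit I x = 22 * chain_energy I x + 7 * (sum x I)\<^sup>2"

definition bump :: "int \<Rightarrow> real \<Rightarrow> int \<Rightarrow> real" where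
  "bump k s j = (if j = k then 5 * s else if j = k - 1 \<or> j = k + 1 then 3 * s else 0)"

lemma sum_cong_support:
  fixes f :: "'a \<Rightarrow> real"
  assumes "finite I" "finite K" "\<And>j. j \<notin> I \<Longrightarrow> f j = 0" "\<And>j. j \<notin> K \<Longrightarrow> f j = 0"
  shows "sum f I = sum f K"
  by (rule sum.mono_neutral_cong) (use assms in auto)

text \<open>
  On three sites with masses \<open>a, b, c\<close> the deficit is
  \<open>18 * (a\<^sup>2 + b\<^sup>2 + c\<^sup>2) - 30 * (a * b + b * c) + 14 * a * c\<close>; completing the square in \<open>b\<close> leaves a
  multiple of \<open>(a - c)\<^sup>2\<close>. The form has rank two, its kernel being spanned by \<open>(3, 5, 3)\<close>.
\<close>

lemma deficit_three_sites:
  assumes "finite I" "\<And>j. j \<notin> I \<Longrightarrow> x j = 0"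
    and supp: "\<And>j. j \<notin> {k - 1, k, k + 1} \<Longrightarrow> x j = 0"
  shows "deficit I x =
    18 * (x k - 5 / 6 * (x (k - 1) + x (k + 1)))\<^sup>2 + 11 / 2 * (x (k - 1) - x (k + 1))\<^sup>2"
proof -
  have "chain_energy I x = (\<Sum>j\<in>{k - 1, k, k + 1}. 1 / 2 * (x j)\<^sup>2 - 2 * x j * x (j - 1))"
    unfolding chain_energy_def by (rule sum_cong_support) (use assms in auto)
  moreover have "x (k - 2) = 0"
    by (rule supp) auto
  moreover have "sum x I = sum x {k - 1, k, k + 1}"
    by (rule sum_cong_support) (use assms in auto)
  ultimately show ?thesis
    unfolding deficit_def by (simp add: power2_eq_square field_simps)
qed

text \<open>
  An empty site cuts every bond between the two sides, so only the square of the total mass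
  couples them.
\<close>

lemma deficit_split:
  assumes "x c = 0"
  defines "A \<equiv> \<lambda>j. if j < c then x j else 0" and "B \<equiv> \<lambda>j. if c < j then x j else 0"
  shows "deficit I x = deficit I A + deficit I B + 14 * sum A I * sum B I"
proof -
  have x: "x j = A j + B j" for j
    using assms by (auto simp: A_def B_def)
  have disjoint: "A j * B j = 0" "A j * B (j - 1) = 0" "A (j - 1) * B j = 0" for j
    using assms by (auto simp: A_def B_def)
  have "1 / 2 * (x j)\<^sup>2 - 2 * x j * x (j - 1) =
     (1 / 2 * (A j)\<^sup>2 - 2 * A j * A (j - 1)) + (1 / 2 * (B j)\<^sup>2 - 2 * B j * B (j - 1))" for j
    unfolding x using disjoint[of j] by (auto simp: power2_eq_square field_simps)
  then have "chain_energy I x = chain_energy I A + chain_energy I B"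
    unfolding chain_energy_def by (simp add: sum.distrib)
  moreover have "sum x I = sum A I + sum B I"
    by (simp add: x[abs_def] sum.distrib)
  ultimately show ?thesis
    unfolding deficit_def by (simp add: power2_eq_square algebra_simps)
qed

lemma chain_energy_along_line:
  "\<exists>L. \<forall>t. chain_energy I (\<lambda>j. x j + t * d j) =
     chain_energy I x + t * L + t\<^sup>2 * chain_energy I d"
proof (intro exI allI)
  fix t
  show "chain_energy I (\<lambda>j. x j + t * d j) =
    chain_energy I x + t * (\<Sum>j\<in>I. x j * d j - 2 * x j * d (j - 1) - 2 * d j * x (j - 1))
      + t\<^sup>2 * chain_energy I d"
    unfolding chain_energy_def sum_distrib_left sum.distrib[symmetric]
    by (rule sum.cong) (simp_all add: power2_eq_square field_simps)
qed

text \<open>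
  With four consecutive occupied sites, \<open>x\<close> is an interior point of a segment on which the
  deficit is strictly concave, so it lies above the value at one of the end points, where one of
  the four sites is empty. Along \<open>(3, 2, -2, -3)\<close> the energy has second-order coefficient
  \<open>13 - 2 * (6 - 4 + 6) = - 3\<close>: the two outer bonds outweigh the squares and the middle bond.
\<close>

lemma deficit_decreases:
  assumes "finite I" and nonneg: "\<And>j. x j \<ge> 0"
    and supp: "\<And>j. j \<notin> I \<Longrightarrow> x j = 0"
    and pos: "x k > 0" "x (k + 1) > 0" "x (k + 2) > 0" "x (k + 3) > 0"
  obtains y where "\<And>j. y j \<ge> 0" "{j. y j \<noteq> 0} \<subset> {j. x j \<noteq> 0}" "deficit I y < deficit I x"
proof -
  define d :: "int \<Rightarrow> real" where
    "d j = (if j = k then 3 else if j = k + 1 then 2 else if j = k + 2 then - 2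
            else if j = k + 3 then - 3 else 0)" for j
  let ?K = "{k, k + 1, k + 2, k + 3}"
  have K: "?K \<subseteq> I"
    using pos supp by (auto intro: ccontr)
  have "sum d I = sum d ?K"
    by (rule sum_cong_support) (use K \<open>finite I\<close> in \<open>auto simp: d_def\<close>)
  then have sum_d: "sum d I = 0"
    by (simp add: d_def)
  have "chain_energy I d = (\<Sum>j\<in>?K. 1 / 2 * (d j)\<^sup>2 - 2 * d j * d (j - 1))"
    unfolding chain_energy_def
    by (rule sum_cong_support) (use K \<open>finite I\<close> in \<open>auto simp: d_def\<close>)
  then have energy_d: "chain_energy I d = - 3"
    by (simp add: d_def)
  obtain L where L: "chain_energy I (\<lambda>j. x j + t * d j) =
      chain_energy I x + t * L + t\<^sup>2 * chain_energy I d" for t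
    using chain_energy_along_line by blast
  have line: "deficit I (\<lambda>j. x j + t * d j) = deficit I x + 22 * (t * L) - 66 * t\<^sup>2" for t
    unfolding deficit_def
    by (simp add: L energy_d sum.distrib sum_distrib_left[symmetric] sum_d)
  \<comment> \<open>The sign of \<open>t\<close> makes the first-order term nonpositive; its size is the largest step that
      keeps the two decreasing masses nonnegative.\<close>
  define t where "t = (if L \<le> 0 then min (x (k + 2) / 2) (x (k + 3) / 3)
                       else - min (x k / 3) (x (k + 1) / 2))"
  have t_range:
    "- x k \<le> 3 * t" "- x (k + 1) \<le> 2 * t" "2 * t \<le> x (k + 2)" "3 * t \<le> x (k + 3)"
    using pos by (simp_all add: t_def min_def)
  define y where "y j = x j + t * d j" for j
  have "t \<noteq> 0"
    using pos by (auto simp: t_def min_def)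
  have "t * L \<le> 0"
    using pos by (auto simp: t_def mult_le_0_iff)
  moreover have "t\<^sup>2 > 0"
    using \<open>t \<noteq> 0\<close> by simp
  ultimately have "deficit I y < deficit I x"
    using line[of t] unfolding y_def[abs_def] by linarith
  moreover have "y j \<ge> 0" for j
    using nonneg[of j] t_range by (simp add: y_def d_def)
  moreover have "{j. y j \<noteq> 0} \<subset> {j. x j \<noteq> 0}"
  proof
    show "{j. y j \<noteq> 0} \<subseteq> {j. x j \<noteq> 0}"
      using pos by (auto simp: y_def d_def split: if_splits)
    have "3 * t = - x k \<or> 2 * t = - x (k + 1) \<or> 2 * t = x (k + 2) \<or> 3 * t = x (k + 3)"
      by (simp add: t_def min_def)
    then have "y k = 0 \<or> y (k + 1) = 0 \<or> y (k + 2) = 0 \<or> y (k + 3) = 0"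
      by (elim disjE) (simp_all add: y_def d_def mult.commute)
    then obtain i where "y i = 0" "x i > 0"
      using pos by metis
    then show "{j. y j \<noteq> 0} \<noteq> {j. x j \<noteq> 0}"
      by force
  qed
  ultimately show ?thesis
    using that by blast
qed

text \<open>
  Only supports contained in a window of three sites can give deficit zero; for all others the
  induction hypothesis, applied to vectors of strictly smaller support, yields a strict
  inequality. The case \<open>s = 0\<close> accounts for \<open>x = 0\<close>.
\<close>

theorem deficit_nonneg:
  assumes "finite I" "\<And>j. x j \<ge> 0" "\<And>j. j \<notin> I \<Longrightarrow> x j = 0"
  shows "deficit I x \<ge> 0 \<and> (deficit I x = 0 \<longrightarrow> (\<exists>k s. x = bump k s))"
  using assms(2,3)
proof (induction "card {j. x j \<noteq> 0}" arbitrary: x rule: less_induct)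
  case less
  let ?S = "{j. x j \<noteq> 0}"
  have fin: "finite ?S"
    by (rule finite_subset[OF _ \<open>finite I\<close>]) (use less.prems in auto)
  have smaller: "deficit I y \<ge> 0"
    if "{j. y j \<noteq> 0} \<subset> ?S" "\<And>j. y j \<ge> 0" for y
  proof -
    have "y j = 0" if "j \<notin> I" for j
      using \<open>{j. y j \<noteq> 0} \<subset> ?S\<close> less.prems(2)[OF that] by auto
    then show ?thesis
      using less.hyps[OF psubset_card_mono[OF fin that(1)]] that(2) by blast
  qed
  have narrow: ?case if "\<And>j. j \<notin> {k - 1, k, k + 1} \<Longrightarrow> x j = 0" for k
  proof -
    let ?a = "x (k - 1)" and ?b = "x k" and ?c = "x (k + 1)"
    have D: "deficit I x = 18 * (?b - 5 / 6 * (?a + ?c))\<^sup>2 + 11 / 2 * (?a - ?c)\<^sup>2"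
      by (rule deficit_three_sites) (use \<open>finite I\<close> less.prems(2) that in auto)
    have "x = bump k (?a / 3)" if "deficit I x = 0"
    proof -
      have "18 * (?b - 5 / 6 * (?a + ?c))\<^sup>2 = 0 \<and> 11 / 2 * (?a - ?c)\<^sup>2 = 0"
        using that unfolding D by (subst (asm) add_nonneg_eq_0_iff) auto
      then have "?c = ?a" "?b = 5 / 3 * ?a"
        by auto
      with \<open>\<And>j. j \<notin> {k - 1, k, k + 1} \<Longrightarrow> x j = 0\<close> show ?thesis
        by (auto simp: bump_def fun_eq_iff)
    qed
    moreover have "deficit I x \<ge> 0"
      unfolding D by simp
    ultimately show ?thesis
      by blast
  qed
  show ?case
  proof (cases "?S = {}")
    case True
    then show ?thesis
      by (intro narrow) auto
  next
    case False
    define k l where "k = Min ?S" and "l = Max ?S"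
    have k: "x k > 0" and l: "x l > 0"
      using Min_in[OF fin False] Max_in[OF fin False] less.prems(1)[of k] less.prems(1)[of l]
      by (auto simp: k_def l_def)
    have range: "k \<le> j \<and> j \<le> l" if "x j \<noteq> 0" for j
      using that fin by (auto simp: k_def l_def)
    consider "l \<le> k + 2" | j where "k < j" "j < l" "x j = 0"
      | "x (k + 1) > 0" "x (k + 2) > 0" "x (k + 3) > 0"
    proof -
      have "\<exists>j. k < j \<and> j < l \<and> x j = 0"
        if "l > k + 2" "\<not> (x (k + 1) > 0 \<and> x (k + 2) > 0 \<and> x (k + 3) > 0)"
      proof -
        from that(2) less.prems(1) have "x (k + 1) = 0 \<or> x (k + 2) = 0 \<or> x (k + 3) = 0"
          by (auto simp: less_le)
        moreover have "k + 3 < l" if "x (k + 3) = 0"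
          using \<open>l > k + 2\<close> l that by (cases "l = k + 3") auto
        ultimately show ?thesis
          using \<open>l > k + 2\<close>
          by (elim disjE) (auto intro: exI[of _ "k + 1"] exI[of _ "k + 2"] exI[of _ "k + 3"])
      qed
      then show ?thesis
        using that by fastforce
    qed
    then show ?thesis
    proof cases
      case 1
      have "x j = 0" if "j \<notin> {k + 1 - 1, k + 1, k + 1 + 1}" for j
        using range[of j] that 1 by force
      then show ?thesis
        by (rule narrow)
    next
      case (2 i)
      define A B where "A = (\<lambda>j. if j < i then x j else 0)"
        and "B = (\<lambda>j. if i < j then x j else 0)"
      have AB: "A j \<ge> 0" "B j \<ge> 0" for j
        using less.prems(1) by (auto simp: A_def B_def)
      have "B k = 0" "A l = 0" "A k = x k" "B l = x l"
        using 2 by (auto simp: A_def B_def)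
      then have "l \<in> ?S - {j. A j \<noteq> 0}" "k \<in> ?S - {j. B j \<noteq> 0}"
        using k l by auto
      moreover have "{j. A j \<noteq> 0} \<subseteq> ?S" "{j. B j \<noteq> 0} \<subseteq> ?S"
        by (auto simp: A_def B_def)
      ultimately have "{j. A j \<noteq> 0} \<subset> ?S" "{j. B j \<noteq> 0} \<subset> ?S"
        by blast+
      then have "deficit I A \<ge> 0" "deficit I B \<ge> 0"
        using smaller AB by blast+
      moreover have "sum A I > 0" "sum B I > 0"
        using \<open>finite I\<close> AB k l \<open>A k = x k\<close> \<open>B l = x l\<close> less.prems(2)[of k] less.prems(2)[of l]
        by (auto intro!: sum_pos2[of _ k A] sum_pos2[of _ l B])
      ultimately have "deficit I x > 0"
        unfolding deficit_split[of x i, OF \<open>x i = 0\<close>, folded A_def B_def]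
        by (intro add_nonneg_pos) auto
      then show ?thesis
        by simp
    next
      case 3
      obtain y where "\<And>j. y j \<ge> 0" "{j. y j \<noteq> 0} \<subset> ?S" "deficit I y < deficit I x"
        using deficit_decreases[OF \<open>finite I\<close> less.prems k 3] by blast
      then show ?thesis
        using smaller[of y] by auto
    qed
  qed
qed

section \<open>Phases\<close>

lemma Re_square_overlap_le: "Re ((cnj z)\<^sup>2 * w\<^sup>2) \<le> (cmod z)\<^sup>2 * (cmod w)\<^sup>2"
  by (metis complex_Re_le_cmod complex_mod_cnj norm_mult norm_power)

text \<open>
  Maximality forces \<open>(cnj u)\<^sup>2 * w\<^sup>2\<close> to be real and nonnegative, so \<open>w\<^sup>2\<close> is a nonnegative multiple
  of \<open>u\<^sup>2\<close>. Taking square roots leaves exactly the sign ambiguity recorded by \<open>site_signs\<close>.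
\<close>

lemma square_overlap_maximal_imp_aligned:
  assumes "z = of_real r * u" "r > 0" "cmod u = 1"
    and "Re ((cnj z)\<^sup>2 * w\<^sup>2) = (cmod z)\<^sup>2 * (cmod w)\<^sup>2"
  obtains \<sigma> where "\<sigma> = 1 \<or> \<sigma> = - 1" "w = \<sigma> * (of_real (cmod w) * u)"
proof -
  let ?v = "(cnj u)\<^sup>2 * w\<^sup>2"
  have u: "cnj u * u = 1"
    by (simp add: assms(3) mult.commute complex_norm_square[symmetric])
  have "(cnj z)\<^sup>2 * w\<^sup>2 = of_real (r\<^sup>2) * ?v"
    by (simp add: assms(1) power_mult_distrib mult.assoc)
  moreover have "Re (of_real c * v) = c * Re v" for c v
    by simp
  ultimately have "r\<^sup>2 * Re ?v = r\<^sup>2 * (cmod w)\<^sup>2"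
    using assms(1-3) assms(4)[symmetric] by (simp only: norm_mult) simp
  then have Re: "Re ?v = cmod ?v"
    using assms by (simp add: norm_mult norm_power)
  moreover have "(cmod ?v)\<^sup>2 = (Re ?v)\<^sup>2 + (Im ?v)\<^sup>2"
    by (rule cmod_power2)
  ultimately have "Im ?v = 0"
    by simp
  with Re have "?v = of_real (cmod ?v)"
    by (simp only: complex_eq_iff Re_complex_of_real Im_complex_of_real)
  then have v: "?v = of_real ((cmod w)\<^sup>2)"
    using assms(3) by (simp add: norm_mult norm_power)
  have "w\<^sup>2 = (cnj u * u)\<^sup>2 * w\<^sup>2"
    by (simp add: u)
  also have "\<dots> = u\<^sup>2 * ?v"
    by (simp add: power_mult_distrib mult_ac)
  also have "\<dots> = (of_real (cmod w) * u)\<^sup>2"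
    unfolding v by (simp add: power_mult_distrib mult_ac)
  finally have "w = of_real (cmod w) * u \<or> w = - (of_real (cmod w) * u)"
    by (simp add: power2_eq_iff)
  then show ?thesis
    using that[of 1] that[of "- 1"] by auto
qed

section \<open>Minimizers\<close>

lemma chain_energy_le_energy:
  "chain_energy {- int N..int N} (\<lambda>j. (cmod (b j))\<^sup>2) \<le> energy N b"
  unfolding chain_energy_def energy_def
proof (rule sum_mono)
  fix j
  show "1 / 2 * ((cmod (b j))\<^sup>2)\<^sup>2 - 2 * (cmod (b j))\<^sup>2 * (cmod (b (j - 1)))\<^sup>2
    \<le> 1 / 2 * cmod (b j) ^ 4 - 2 * Re ((cnj (b j))\<^sup>2 * (b (j - 1))\<^sup>2)"
    using Re_square_overlap_le[of "b j" "b (j - 1)"] by (simp flip: power_mult)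
qed

lemma energy_eq_chain_energy_imp:
  assumes "energy N b \<le> chain_energy {- int N..int N} (\<lambda>j. (cmod (b j))\<^sup>2)"
    and "j \<in> {- int N..int N}"
  shows "Re ((cnj (b j))\<^sup>2 * (b (j - 1))\<^sup>2) = (cmod (b j))\<^sup>2 * (cmod (b (j - 1)))\<^sup>2"
proof -
  let ?gap = "\<lambda>j. (cmod (b j))\<^sup>2 * (cmod (b (j - 1)))\<^sup>2 - Re ((cnj (b j))\<^sup>2 * (b (j - 1))\<^sup>2)"
  have gap: "?gap i \<ge> 0" for i
    using Re_square_overlap_le by simp
  have "energy N b = chain_energy {- int N..int N} (\<lambda>j. (cmod (b j))\<^sup>2)
      + 2 * (\<Sum>i = - int N..int N. ?gap i)"
    unfolding energy_def chain_energy_def sum_distrib_left sum.distrib[symmetric]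
    by (rule sum.cong) (simp_all flip: power_mult)
  with assms(1) have "(\<Sum>i = - int N..int N. ?gap i) \<le> 0"
    by simp
  then have "(\<Sum>i = - int N..int N. ?gap i) = 0"
    using sum_nonneg[of "{- int N..int N}" ?gap] gap by fastforce
  then have "?gap j = 0"
    using assms(2) gap by (subst (asm) sum_nonneg_eq_0_iff) auto
  then show ?thesis
    by simp
qed

lemma energy_lower_bound:
  assumes "b \<in> states N"
  shows "energy N b \<ge> - 7 / 22 * (mass N b)\<^sup>2"
    and "energy N b \<le> - 7 / 22 * (mass N b)\<^sup>2 \<Longrightarrow>
      (\<exists>k s. (\<lambda>j. (cmod (b j))\<^sup>2) = bump k s) \<and>
      (\<forall>j\<in>{- int N..int N}.
         Re ((cnj (b j))\<^sup>2 * (b (j - 1))\<^sup>2) = (cmod (b j))\<^sup>2 * (cmod (b (j - 1)))\<^sup>2)"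
proof -
  let ?I = "{- int N..int N}" and ?x = "\<lambda>j. (cmod (b j))\<^sup>2"
  have D: "deficit ?I ?x \<ge> 0 \<and> (deficit ?I ?x = 0 \<longrightarrow> (\<exists>k s. ?x = bump k s))"
    by (rule deficit_nonneg) (use assms in \<open>auto simp: states_def\<close>)
  have eq: "chain_energy ?I ?x = - 7 / 22 * (mass N b)\<^sup>2 + deficit ?I ?x / 22"
    by (simp add: deficit_def mass_def field_simps)
  note le = chain_energy_le_energy[of N b]
  show "energy N b \<ge> - 7 / 22 * (mass N b)\<^sup>2"
    using D eq le by linarith
  assume E: "energy N b \<le> - 7 / 22 * (mass N b)\<^sup>2"
  then have "deficit ?I ?x = 0" "energy N b \<le> chain_energy ?I ?x"
    using D eq le by linarith+
  then show "(\<exists>k s. ?x = bump k s) \<and>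
      (\<forall>j\<in>?I. Re ((cnj (b j))\<^sup>2 * (b (j - 1))\<^sup>2) = (cmod (b j))\<^sup>2 * (cmod (b (j - 1)))\<^sup>2)"
    using D energy_eq_chain_energy_imp[of N b] by blast
qed

lemma three_node_in_states:
  "k \<in> {- int N + 1..int N - 1} \<Longrightarrow> three_node m k \<theta> \<in> states N"
  by (auto simp: states_def three_node_def)

lemma sum_bump:
  assumes "k \<in> {- int N + 1..int N - 1}"
  shows "(\<Sum>j = - int N..int N. bump k s j) = 11 * s"
proof -
  have "(\<Sum>j = - int N..int N. bump k s j) = (\<Sum>j\<in>{k - 1, k, k + 1}. bump k s j)"
    by (rule sum_cong_support) (use assms in \<open>auto simp: bump_def\<close>)
  then show ?thesis
    by (simp add: bump_def)
qed

text \<open>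
  The profile has total mass \<open>11 * s\<close>, which is \<open>m\<close> for \<open>s = m / 11\<close>.
\<close>

lemma three_node_polar:
  "three_node m k \<theta> j = of_real (sqrt (bump k (m / 11) j)) * cis \<theta>"
  by (simp add: three_node_def bump_def)

lemma
  assumes "k \<in> {- int N + 1..int N - 1}" "m \<ge> 0"
  shows mass_three_node: "mass N (three_node m k \<theta>) = m"
    and energy_three_node: "energy N (three_node m k \<theta>) = - 7 / 22 * m\<^sup>2"
proof -
  let ?I = "{- int N..int N}" and ?x = "bump k (m / 11)"
  have nonneg: "?x j \<ge> 0" for j
    using assms(2) by (simp add: bump_def)
  have norm: "(cmod (three_node m k \<theta> j))\<^sup>2 = ?x j" for j
    using nonneg[of j] by (simp add: three_node_polar norm_mult)
  show "mass N (three_node m k \<theta>) = m"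
    unfolding mass_def norm using sum_bump[OF assms(1), of "m / 11"] by simp
  have "deficit ?I ?x =
      18 * (?x k - 5 / 6 * (?x (k - 1) + ?x (k + 1)))\<^sup>2 + 11 / 2 * (?x (k - 1) - ?x (k + 1))\<^sup>2"
    by (rule deficit_three_sites) (use assms(1) in \<open>auto simp: bump_def\<close>)
  then have "deficit ?I ?x = 0"
    by (simp add: bump_def)
  then have "chain_energy ?I ?x = - 7 / 22 * m\<^sup>2"
    using sum_bump[OF assms(1), of "m / 11"] by (simp add: deficit_def)
  moreover have "energy N (three_node m k \<theta>) = chain_energy ?I ?x"
    unfolding energy_def chain_energy_def
  proof (rule sum.cong[OF refl])
    fix j
    have "(cnj (three_node m k \<theta> j))\<^sup>2 * (three_node m k \<theta> (j - 1))\<^sup>2 =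
        of_real ((sqrt (?x j))\<^sup>2 * (sqrt (?x (j - 1)))\<^sup>2) * (cnj (cis \<theta>) * cis \<theta>)\<^sup>2"
      by (simp add: three_node_polar power_mult_distrib mult_ac)
    also have "\<dots> = of_real (?x j * ?x (j - 1))"
      using nonneg by (simp add: cis_cnj cis_mult)
    finally have "Re ((cnj (three_node m k \<theta> j))\<^sup>2 * (three_node m k \<theta> (j - 1))\<^sup>2) =
        ?x j * ?x (j - 1)"
      by simp
    moreover have "cmod (three_node m k \<theta> j) ^ 4 = (?x j)\<^sup>2"
      by (simp flip: norm power_mult)
    ultimately show "1 / 2 * cmod (three_node m k \<theta> j) ^ 4
        - 2 * Re ((cnj (three_node m k \<theta> j))\<^sup>2 * (three_node m k \<theta> (j - 1))\<^sup>2)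
      = 1 / 2 * (?x j)\<^sup>2 - 2 * ?x j * ?x (j - 1)"
      by simp
  qed
  ultimately show "energy N (three_node m k \<theta>) = - 7 / 22 * m\<^sup>2"
    by simp
qed

lemma is_minimizer_three_node:
  assumes "k \<in> {- int N + 1..int N - 1}" "m \<ge> 0"
  shows "is_minimizer N m (three_node m k \<theta>)"
  using three_node_in_states[OF assms(1)] mass_three_node[OF assms] energy_three_node[OF assms]
    energy_lower_bound(1)[of _ N]
  unfolding is_minimizer_def by auto

text \<open>
  Comparing with a three-node state centred at \<open>0\<close>, which fits because \<open>N \<ge> 1\<close>, shows that a
  minimizer attains the lower bound; hence its masses form a bump, and every bond is
  maximal. The bump cannot overlap the boundary, since its outer sites carry
  nonzero mass.
\<close>

lemma minimizer_imp_three_node: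
  assumes "N \<ge> 1" "m > 0" "is_minimizer N m b"
  shows "\<exists>k\<in>{- int N + 1..int N - 1}. \<exists>\<theta>\<in>{0..<2 * pi}. \<exists>\<sigma>\<in>site_signs.
           \<forall>j. b j = \<sigma> j * three_node m k \<theta> j"
proof -
  from assms(3) have b: "b \<in> states N" and mass: "mass N b = m"
    by (auto simp: is_minimizer_def)
  have 0: "0 \<in> {- int N + 1..int N - 1}" "m \<ge> 0"
    using assms by auto
  have "energy N b \<le> energy N (three_node m 0 0)"
    using assms(3) three_node_in_states[OF 0(1)] mass_three_node[OF 0]
    by (auto simp: is_minimizer_def)
  then have "energy N b \<le> - 7 / 22 * (mass N b)\<^sup>2"
    by (simp add: energy_three_node[OF 0] mass)
  from energy_lower_bound(2)[OF b this] obtain k s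
    where x: "\<And>j. (cmod (b j))\<^sup>2 = bump k s j"
      and re: "\<And>j. j \<in> {- int N..int N} \<Longrightarrow>
        Re ((cnj (b j))\<^sup>2 * (b (j - 1))\<^sup>2) = (cmod (b j))\<^sup>2 * (cmod (b (j - 1)))\<^sup>2"
    by (metis (no_types, lifting))
  have "s \<noteq> 0"
  proof
    assume "s = 0"
    then have "mass N b = 0"
      unfolding mass_def x by (intro sum.neutral) (simp add: bump_def)
    with mass assms(2) show False
      by simp
  qed
  have in_range: "j \<in> {- int N..int N}" if "bump k s j \<noteq> 0" for j
    using x[of j] that b by (auto simp: states_def)
  from in_range[of "k - 1"] in_range[of "k + 1"] \<open>s \<noteq> 0\<close>
  have k: "k \<in> {- int N + 1..int N - 1}"
    by (auto simp: bump_def)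
  have "s = m / 11"
    using sum_bump[OF k, of s] mass by (simp add: mass_def x)
  then have norm: "cmod (b j) = sqrt (bump k (m / 11) j)" for j
    using x[of j] by (metis norm_ge_zero real_sqrt_unique)
  define u where "u = b k / of_real (cmod (b k))"
  have "cmod (b k) > 0"
    using assms(2) by (simp add: norm bump_def)
  then have u: "b k = of_real (cmod (b k)) * u" "cmod u = 1"
    by (auto simp: u_def norm_divide)
  obtain \<theta> where \<theta>: "0 \<le> \<theta>" "\<theta> < 2 * pi" "u = cis \<theta>"
  proof -
    have "(Re u)\<^sup>2 + (Im u)\<^sup>2 = 1"
      using u(2) by (simp add: cmod_power2[symmetric])
    then obtain t where "0 \<le> t" "t < 2 * pi" "Re u = cos t" "Im u = sin t"
      by (rule sincos_total_2pi)
    then show ?thesis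
      using that[of t] by (simp add: complex_eq_iff)
  qed
  \<comment> \<open>The bond at \<open>j\<close> joins \<open>j - 1\<close> to \<open>j\<close>, so the right neighbour is reached through the bond at
      \<open>k + 1\<close>, read backwards by conjugation.\<close>
  have left: "Re ((cnj (b k))\<^sup>2 * (b (k - 1))\<^sup>2) = (cmod (b k))\<^sup>2 * (cmod (b (k - 1)))\<^sup>2"
    using re[of k] k by auto
  have "(cnj (b k))\<^sup>2 * (b (k + 1))\<^sup>2 = cnj ((cnj (b (k + 1)))\<^sup>2 * (b k)\<^sup>2)"
    by (simp add: mult.commute)
  then have right: "Re ((cnj (b k))\<^sup>2 * (b (k + 1))\<^sup>2) = (cmod (b k))\<^sup>2 * (cmod (b (k + 1)))\<^sup>2"
    using re[of "k + 1"] k by (simp only: cnj.sel) (simp add: mult.commute)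
  obtain \<sigma>l where \<sigma>l: "\<sigma>l = 1 \<or> \<sigma>l = - 1" "b (k - 1) = \<sigma>l * (of_real (cmod (b (k - 1))) * u)"
    using square_overlap_maximal_imp_aligned[OF u(1) \<open>cmod (b k) > 0\<close> u(2) left] .
  obtain \<sigma>r where \<sigma>r: "\<sigma>r = 1 \<or> \<sigma>r = - 1" "b (k + 1) = \<sigma>r * (of_real (cmod (b (k + 1))) * u)"
    using square_overlap_maximal_imp_aligned[OF u(1) \<open>cmod (b k) > 0\<close> u(2) right] .
  define \<sigma> where "\<sigma> j = (if j = k - 1 then \<sigma>l else if j = k + 1 then \<sigma>r else 1)" for j
  have "\<sigma> \<in> site_signs"
    using \<sigma>l \<sigma>r by (auto simp: site_signs_def \<sigma>_def)
  have polar: "three_node m k \<theta> j = of_real (cmod (b j)) * u" for j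
    unfolding three_node_polar norm \<theta>(3) ..
  have "b j = \<sigma> j * three_node m k \<theta> j" for j
  proof -
    consider "j = k - 1" | "j = k" | "j = k + 1" | "j \<notin> {k - 1, k, k + 1}"
      by blast
    then show ?thesis
    proof cases
      case 1
      then show ?thesis
        using \<sigma>l(2) by (simp add: polar \<sigma>_def)
    next
      case 2
      then show ?thesis
        using u(1) by (simp add: polar \<sigma>_def)
    next
      case 3
      then show ?thesis
        using \<sigma>r(2) by (simp add: polar \<sigma>_def)
    next
      case 4
      then have "cmod (b j) = 0"
        by (simp add: norm bump_def)
      then show ?thesis
        by (simp add: polar)
    qed
  qed
  moreover have "\<theta> \<in> {0..<2 * pi}"
    using \<theta> by simp
  ultimately show ?thesis
    using k \<open>\<sigma> \<in> site_signs\<close> by blast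
qed

theorem theorem1:
  fixes N :: nat and m :: real
  assumes "N \<ge> 1" and "m > 0"
  shows
    "(\<exists>b. is_3node b \<and> is_minimizer N m b) \<and>
     (\<forall>b c. is_minimizer N m b \<and> is_minimizer N m c \<longrightarrow>
        (\<exists>(d::int) (\<theta>::real). \<exists>\<sigma>\<in>site_signs. \<forall>j. c j = \<sigma> j * cis \<theta> * b (j - d))) \<and>
     (\<forall>k\<in>{- int N + 1..int N - 1}. \<forall>\<theta>\<in>{0..<2 * pi}. is_minimizer N m (three_node m k \<theta>)) \<and>
     (\<forall>b. is_minimizer N m b \<longleftrightarrow>
        (\<exists>k\<in>{- int N + 1..int N - 1}. \<exists>\<theta>\<in>{0..<2 * pi}. \<exists>\<sigma>\<in>site_signs.
           \<forall>j. b j = \<sigma> j * three_node m k \<theta> j))"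
proof (intro conjI allI ballI impI)
  have "is_3node (three_node m 0 0)"
    unfolding is_3node_def using assms by (intro exI[of _ 0]) (auto simp: three_node_def)
  moreover have "is_minimizer N m (three_node m 0 0)"
    using assms by (intro is_minimizer_three_node) auto
  ultimately show "\<exists>b. is_3node b \<and> is_minimizer N m b"
    by blast
next
  fix b c
  assume "is_minimizer N m b \<and> is_minimizer N m c"
  then obtain k \<theta> \<sigma> k' \<theta>' \<sigma>'
    where \<sigma>: "\<sigma> \<in> site_signs" "\<sigma>' \<in> site_signs"
      and b: "\<And>j. b j = \<sigma> j * three_node m k \<theta> j"
      and c: "\<And>j. c j = \<sigma>' j * three_node m k' \<theta>' j"
    using minimizer_imp_three_node[OF assms] by meson
  \<comment> \<open>Shifting \<open>b\<close> by \<open>k' - k\<close> carries its signs along; \<open>\<tau>\<close> cancels them and inserts those of \<open>c\<close>.\<close>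
  define \<tau> where "\<tau> j = \<sigma>' j * \<sigma> (j - (k' - k))" for j
  have "\<tau> j = 1 \<or> \<tau> j = - 1" for j
  proof -
    have "\<sigma> i = 1 \<or> \<sigma> i = - 1" "\<sigma>' i = 1 \<or> \<sigma>' i = - 1" for i
      using \<sigma> by (auto simp: site_signs_def)
    from this(1)[of "j - (k' - k)"] this(2)[of j] show ?thesis
      by (auto simp: \<tau>_def)
  qed
  then have "\<tau> \<in> site_signs"
    by (simp add: site_signs_def)
  moreover have "c j = \<tau> j * cis (\<theta>' - \<theta>) * b (j - (k' - k))" for j
  proof -
    let ?i = "j - (k' - k)"
    have "bump k' (m / 11) j = bump k (m / 11) ?i"
      by (auto simp: bump_def)
    then have "three_node m k' \<theta>' j = cis (\<theta>' - \<theta>) * three_node m k \<theta> ?i"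
      by (simp add: three_node_polar cis_mult mult.left_commute)
    moreover have "\<sigma> ?i * \<sigma> ?i = 1"
      using site_signs_simps(1)[OF \<sigma>(1)] by (simp add: power2_eq_square)
    ultimately show ?thesis
      unfolding b c \<tau>_def by (simp add: mult_ac)
  qed
  ultimately show "\<exists>(d::int) (\<theta>::real). \<exists>\<sigma>\<in>site_signs. \<forall>j. c j = \<sigma> j * cis \<theta> * b (j - d)"
    by blast
next
  fix k \<theta>
  assume "k \<in> {- int N + 1..int N - 1}"
  then show "is_minimizer N m (three_node m k \<theta>)"
    using assms by (intro is_minimizer_three_node) auto
next
  fix b
  show "is_minimizer N m b \<longleftrightarrow>
        (\<exists>k\<in>{- int N + 1..int N - 1}. \<exists>\<theta>\<in>{0..<2 * pi}. \<exists>\<sigma>\<in>site_signs.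
           \<forall>j. b j = \<sigma> j * three_node m k \<theta> j)" (is "_ \<longleftrightarrow> ?family")
  proof
    show "is_minimizer N m b \<Longrightarrow> ?family"
      by (rule minimizer_imp_three_node[OF assms])
  next
    assume ?family
    then obtain k \<theta> \<sigma> where k: "k \<in> {- int N + 1..int N - 1}" and "\<sigma> \<in> site_signs"
      and "b = (\<lambda>j. \<sigma> j * three_node m k \<theta> j)"
      by blast
    then show "is_minimizer N m b"
      using is_minimizer_site_signs is_minimizer_three_node[OF k] assms by auto
  qed
qed

end
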